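(* Let $k,n,m$ be natural numbers and let $F_1(z),\dots,F_k(z)$ be $m\times m$-valued rational functions. Assume that they all admit $(n+m)\times(n+m)$ realizations $R_{F_j}=\begin{pmatrix}A_j&B_j\\C_j&D_j\end{pmatrix}$, i.e. $F_j(z)=C_j(zI_n-A_j)^{-1}B_j+D_j$, such that $$\begin{pmatrix}I_n&0\\0&I_m\end{pmatrix}-R_{F_j}^*\begin{pmatrix}I_n&0\\0&I_m\end{pmatrix}R_{F_j}\quad\text{is positive semidefinite},\qquad j=1,\dots,k.$$ Let $\upsilon_j=\begin{pmatrix}\upsilon_{j,n}&0\\0&\upsilon_{j,m}\end{pmatrix}\in\mathbb C^{(n+m)\times(n+m)}$, $j=1,\dots,k$, be arbitrary block-diagonal matrices (with $\upsilon_{j,n}$ of size $n\times n$ and $\upsilon_{j,m}$ of size $m\times m$) satisfying $\sum_{j=1}^k\upsilon_j^*\upsilon_j=\begin{pmatrix}I_n&0\\0&I_m\end{pmatrix}$, and put $$R_F=\sum_{j=1}^k\upsilon_j^*R_{F_j}\upsilon_j=\begin{pmatrix}A&B\\C&D\end{pmatrix}.$$ Then $I_{n+m}-R_F^*R_F$ is positive semidefinite, and thus the associated function $F(z)=C(zI_n-A)^{-1}B+D$ is a rational $\mathcal{DB}$ function.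
   Context: An $(n+m)\times(n+m)$ realization array (matrix) $R_F=\begin{pmatrix}A&B\\C&D\end{pmatrix}$ with $A$ of size $n\times n$ and $D$ of size $m\times m$ is a state-space realization of the $m\times m$-valued rational function $F(z)=C(zI_n-A)^{-1}B+D$ (not necessarily minimal). $\mathcal{DB}$ denotes the Discrete-time Bounded real rational functions: the $m\times m$-valued real rational functions $F$ (real meaning $F(z)\in\mathbb R^{m\times m}$ for every $z\in\mathbb R$ that is not a pole) such that $I_m-F(z)^*F(z)$ is positive semidefinite for all $z\in\mathbb C$ with $|z|>1$.
   Formalization: With complex data F need not be real (k=n=m=1, υ=I, A=B=C=0, D=i gives F=i), so the formal result proves the psd claim and the inequality I−F*F≥0 for |z|>1 (no poles there) in general, and the reality part of DB only when R_F is real. *)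

theory Defs
  imports
    "HOL-Computational_Algebra.Normalized_Fraction"
    "HOL-Computational_Algebra.Polynomial_Factorial"
    "HOL-Computational_Algebra.Field_as_Ring"
    "Jordan_Normal_Form.Schur_Decomposition"
    "Jordan_Normal_Form.Gauss_Jordan_Elimination"
begin

text \<open>
  A scalar rational function is an element of the field \<^typ>\<open>complex poly fract\<close>, and a
  matrix-valued rational function is a matrix over that field. Values and poles are read off from
  the representation in lowest terms, so removable singularities are not poles.
\<close>

type_synonym rat_fun = "complex poly fract"

definition rat_pole :: "rat_fun \<Rightarrow> complex \<Rightarrow> bool" where
  "rat_pole f z \<longleftrightarrow> poly (snd (quot_of_fract f)) z = 0"

definition rat_eval :: "rat_fun \<Rightarrow> complex \<Rightarrow> complex" where
  "rat_eval f z = poly (fst (quot_of_fract f)) z / poly (snd (quot_of_fract f)) z"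

definition mat_pole :: "rat_fun mat \<Rightarrow> complex \<Rightarrow> bool" where
  "mat_pole F z \<longleftrightarrow> (\<exists>f \<in> elements_mat F. rat_pole f z)"

definition mat_eval :: "rat_fun mat \<Rightarrow> complex \<Rightarrow> complex mat" where
  "mat_eval F z = map_mat (\<lambda>f. rat_eval f z) F"

definition const_mat :: "complex mat \<Rightarrow> rat_fun mat" where
  "const_mat = map_mat (\<lambda>c. to_fract [:c:])"

text \<open>
  The rational function \<open>C (z I - A)\<^sup>-\<^sup>1 B + D\<close>. The library's \<^const>\<open>char_poly_matrix\<close> is the
  polynomial matrix \<open>z I - A\<close>; its determinant is monic, so it is always invertible over the
  field of rational functions.
\<close>

definition realized_fun ::
  "complex mat \<Rightarrow> complex mat \<Rightarrow> complex mat \<Rightarrow> complex mat \<Rightarrow> rat_fun mat" where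
  "realized_fun A B C D =
     const_mat C * the (mat_inverse (map_mat to_fract (char_poly_matrix A))) * const_mat B
       + const_mat D"

definition psd :: "nat \<Rightarrow> complex mat \<Rightarrow> bool" where
  "psd d M \<longleftrightarrow> M \<in> carrier_mat d d \<and> mat_adjoint M = M \<and>
     (\<forall>v \<in> carrier_vec d. 0 \<le> Re ((M *\<^sub>v v) \<bullet>c v))"

text \<open>
  Matrices of all sizes share one type, which therefore has no zero; the sum of a family of
  \<open>d \<times> d\<close> matrices is written entrywise.
\<close>

definition sum_mats :: "nat \<Rightarrow> ('i \<Rightarrow> complex mat) \<Rightarrow> 'i set \<Rightarrow> complex mat" where
  "sum_mats d f J = mat d d (\<lambda>(a, b). \<Sum>j\<in>J. f j $$ (a, b))"

definition real_matrix :: "complex mat \<Rightarrow> bool" where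
  "real_matrix M \<longleftrightarrow> elements_mat M \<subseteq> \<real>"

definition real_rational :: "rat_fun mat \<Rightarrow> bool" where
  "real_rational F \<longleftrightarrow> (\<forall>x::real. \<not> mat_pole F (of_real x) \<longrightarrow> real_matrix (mat_eval F (of_real x)))"

text \<open>
  Discrete-time bounded functions, without and with the reality requirement; they are kept apart
  because complex arrays and complex weights yield the inequality but need not
  yield reality (\<open>F = \<i>\<close> has the array \<open>diag(0, \<i>)\<close>, a contraction). The inequality for
  all \<open>z\<close> outside the closed unit disc includes that \<open>F\<close> has no pole there.
\<close>

definition discrete_bounded :: "nat \<Rightarrow> rat_fun mat set" where
  "discrete_bounded m = {F \<in> carrier_mat m m. \<forall>z. 1 < cmod z \<longrightarrow>
     \<not> mat_pole F z \<and> psd m (1\<^sub>m m - mat_adjoint (mat_eval F z) * mat_eval F z)}"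

definition DB :: "nat \<Rightarrow> rat_fun mat set" where
  "DB m = {F \<in> discrete_bounded m. real_rational F}"

end

theory Submission
  imports Defs
begin

text \<open>
  A matrix \<open>M\<close> satisfies \<open>I - M\<^sup>* M \<ge> 0\<close> iff it is a contraction. If \<open>y = R x\<close> with
  \<open>R = \<Sum>\<^sub>j v\<^sub>j\<^sup>* R\<^sub>j v\<^sub>j\<close>, then \<open>\<parallel>y\<parallel>\<^sup>2 = \<Sum>\<^sub>j \<langle>R\<^sub>j v\<^sub>j x, v\<^sub>j y\<rangle> \<le> \<Sum>\<^sub>j (\<parallel>v\<^sub>j x\<parallel>\<^sup>2 + \<parallel>v\<^sub>j y\<parallel>\<^sup>2) / 2
  = (\<parallel>x\<parallel>\<^sup>2 + \<parallel>y\<parallel>\<^sup>2) / 2\<close>, so \<open>R\<close> is a contraction.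

  For \<open>\<bar>z\<bar> > 1\<close> the contraction \<open>A\<close> does not have the eigenvalue \<open>z\<close>, so \<open>F\<close> has no pole at \<open>z\<close>,
  and the state \<open>x = (z I - A)\<^sup>-\<^sup>1 B u\<close> gives \<open>R (x, u) = (z x, F(z) u)\<close>. Contractivity then reads
  \<open>\<bar>z\<bar>\<^sup>2 \<parallel>x\<parallel>\<^sup>2 + \<parallel>F(z) u\<parallel>\<^sup>2 \<le> \<parallel>x\<parallel>\<^sup>2 + \<parallel>u\<parallel>\<^sup>2\<close>, whence \<open>\<parallel>F(z) u\<parallel> \<le> \<parallel>u\<parallel>\<close>.
  Writing \<open>(z I - A)\<^sup>-\<^sup>1\<close> as adjugate over characteristic polynomial makes every entry of \<open>F\<close> an
  explicit quotient of polynomials, with real coefficients if \<open>R\<close> is real.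
\<close>

definition sqnorm :: "complex vec \<Rightarrow> real" where
  "sqnorm v = Re (v \<bullet>c v)"

lemma sqnorm_sum: "sqnorm v = (\<Sum>i<dim_vec v. (cmod (v $ i))\<^sup>2)"
  unfolding cmod_power2 by (simp add: sqnorm_def scalar_prod_def atLeast0LessThan power2_eq_square)

lemma sqnorm_nonneg: "0 \<le> sqnorm v"
  by (simp add: sqnorm_sum sum_nonneg)

lemma sqnorm_smult: "sqnorm (c \<cdot>\<^sub>v v) = (cmod c)\<^sup>2 * sqnorm v"
  by (simp add: sqnorm_sum norm_mult power_mult_distrib sum_distrib_left)

lemma sqnorm_append: "sqnorm (v @\<^sub>v w) = sqnorm v + sqnorm w"
proof -
  have v: "v \<in> carrier_vec (dim_vec v)" and w: "w \<in> carrier_vec (dim_vec w)" by simp_all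
  have "conjugate (v @\<^sub>v w) = conjugate v @\<^sub>v conjugate w"
    by (intro eq_vecI) auto
  then show ?thesis
    using scalar_prod_append[OF v w carrier_vec_conjugate[OF v] carrier_vec_conjugate[OF w]]
    by (simp add: sqnorm_def)
qed

lemma sqnorm_zero_vec: "sqnorm (0\<^sub>v n) = 0"
  by (simp add: sqnorm_sum)

lemma sqnorm_eq_0:
  assumes "v \<in> carrier_vec n" "sqnorm v = 0"
  shows "v = 0\<^sub>v n"
proof (rule eq_vecI)
  have "\<forall>i\<in>{..<dim_vec v}. (cmod (v $ i))\<^sup>2 = 0"
    using assms(2) by (subst sum_nonneg_eq_0_iff[symmetric]) (auto simp: sqnorm_sum)
  then show "v $ i = 0\<^sub>v n $ i" if "i < dim_vec (0\<^sub>v n)" for i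
    using that assms(1) by auto
qed (use assms in auto)

lemma Re_cscalar_prod_le:
  assumes "v \<in> carrier_vec n" "w \<in> carrier_vec n"
  shows "Re (v \<bullet>c w) \<le> (sqnorm v + sqnorm w) / 2"
proof -
  have "Re (a * cnj b) \<le> ((cmod a)\<^sup>2 + (cmod b)\<^sup>2) / 2" for a b
    using sum_squares_ge_zero[of "Re a - Re b" "Im a - Im b"]
    unfolding cmod_power2 by (simp add: power2_eq_square algebra_simps)
  then have "(\<Sum>i<n. Re (v $ i * cnj (w $ i)))
      \<le> (\<Sum>i<n. ((cmod (v $ i))\<^sup>2 + (cmod (w $ i))\<^sup>2) / 2)"
    by (intro sum_mono)
  also have "\<dots> = (sqnorm v + sqnorm w) / 2"
    using assms by (simp add: sqnorm_sum sum.distrib flip: sum_divide_distrib)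
  finally show ?thesis
    using assms by (simp add: scalar_prod_def atLeast0LessThan)
qed

lemma mat_adjoint_transpose: "mat_adjoint A = transpose_mat (map_mat conjugate A)"
  by (rule eq_matI) (auto simp: mat_adjoint_def mat_of_rows_def)

lemma mat_adjoint_carrier [simp]: "A \<in> carrier_mat r c \<Longrightarrow> mat_adjoint A \<in> carrier_mat c r"
  by (auto simp: mat_adjoint_transpose)

lemma mat_adjoint_cscalar_prod:
  fixes A :: "complex mat"
  assumes "A \<in> carrier_mat r c" "x \<in> carrier_vec c" "y \<in> carrier_vec r"
  shows "(mat_adjoint A *\<^sub>v y) \<bullet>c x = y \<bullet>c (A *\<^sub>v x)"
proof -
  have "conjugate (A *\<^sub>v x) = map_mat conjugate A *\<^sub>v conjugate x"
    using assms by (intro eq_vecI) (auto simp: scalar_prod_def)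
  then show ?thesis
    using assms transpose_vec_mult_scalar[of "map_mat conjugate A" r c "conjugate x" y]
    by (simp add: mat_adjoint_transpose)
qed

lemma psd_one_minus_adjoint_mult_iff:
  assumes M: "M \<in> carrier_mat r d"
  shows "psd d (1\<^sub>m d - mat_adjoint M * M) \<longleftrightarrow> (\<forall>x\<in>carrier_vec d. sqnorm (M *\<^sub>v x) \<le> sqnorm x)"
proof -
  let ?P = "1\<^sub>m d - mat_adjoint M * M"
  have aM: "mat_adjoint M \<in> carrier_mat d r" using M by simp
  have "mat_adjoint ?P = ?P"
    using M by (intro eq_matI) (auto simp: mat_adjoint_transpose scalar_prod_def mult.commute)
  moreover have "Re ((?P *\<^sub>v x) \<bullet>c x) = sqnorm x - sqnorm (M *\<^sub>v x)" if x: "x \<in> carrier_vec d" for x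
  proof -
    have "?P *\<^sub>v x = x - mat_adjoint M *\<^sub>v (M *\<^sub>v x)"
      using minus_mult_distrib_mat_vec[OF one_carrier_mat mult_carrier_mat[OF aM M] x]
        assoc_mult_mat_vec[OF aM M x] x by simp
    then have "(?P *\<^sub>v x) \<bullet>c x = x \<bullet>c x - (mat_adjoint M *\<^sub>v (M *\<^sub>v x)) \<bullet>c x"
      using M aM x by (simp add: minus_scalar_prod_distrib[OF x mult_mat_vec_carrier[OF aM]])
    also have "(mat_adjoint M *\<^sub>v (M *\<^sub>v x)) \<bullet>c x = (M *\<^sub>v x) \<bullet>c (M *\<^sub>v x)"
      using M x by (intro mat_adjoint_cscalar_prod) auto
    finally show ?thesis by (simp add: sqnorm_def)
  qed
  ultimately show ?thesis
    using M aM by (simp add: psd_def minus_carrier_mat[OF mult_carrier_mat[OF aM M]])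
qed

lemma sum_mats_cscalar_prod:
  assumes f: "\<And>j. j \<in> J \<Longrightarrow> f j \<in> carrier_mat d d"
    and x: "x \<in> carrier_vec d" and y: "y \<in> carrier_vec d"
  shows "(sum_mats d f J *\<^sub>v x) \<bullet>c y = (\<Sum>j\<in>J. (f j *\<^sub>v x) \<bullet>c y)"
proof -
  have "(sum_mats d f J *\<^sub>v x) \<bullet>c y
      = (\<Sum>a<d. \<Sum>b<d. \<Sum>j\<in>J. f j $$ (a, b) * x $ b * cnj (y $ a))"
    using x y
    by (simp add: sum_mats_def scalar_prod_def sum_distrib_right atLeast0LessThan)
  also have "\<dots> = (\<Sum>j\<in>J. \<Sum>a<d. \<Sum>b<d. f j $$ (a, b) * x $ b * cnj (y $ a))"
    by (simp add: sum.swap[of _ J])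
  also have "\<dots> = (\<Sum>j\<in>J. (f j *\<^sub>v x) \<bullet>c y)"
  proof (rule sum.cong[OF refl])
    fix j assume "j \<in> J"
    then show "(\<Sum>a<d. \<Sum>b<d. f j $$ (a, b) * x $ b * cnj (y $ a)) = (f j *\<^sub>v x) \<bullet>c y"
      using f[of j] x y
      by (auto simp: scalar_prod_def sum_distrib_right atLeast0LessThan)
  qed
  finally show ?thesis .
qed

lemma contraction_sum_mats:
  assumes T: "\<And>j. j \<in> J \<Longrightarrow> T j \<in> carrier_mat d d"
    and V: "\<And>j. j \<in> J \<Longrightarrow> V j \<in> carrier_mat d d"
    and contr: "\<And>j u. j \<in> J \<Longrightarrow> u \<in> carrier_vec d \<Longrightarrow> sqnorm (T j *\<^sub>v u) \<le> sqnorm u"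
    and one: "sum_mats d (\<lambda>j. mat_adjoint (V j) * V j) J = 1\<^sub>m d"
    and x: "x \<in> carrier_vec d"
  shows "sqnorm (sum_mats d (\<lambda>j. mat_adjoint (V j) * T j * V j) J *\<^sub>v x) \<le> sqnorm x"
proof -
  define y where "y = sum_mats d (\<lambda>j. mat_adjoint (V j) * T j * V j) J *\<^sub>v x"
  have y: "y \<in> carrier_vec d"
    unfolding y_def using x by (intro mult_mat_vec_carrier[where n = d]) (simp_all add: sum_mats_def)
  have sum_sqnorm: "(\<Sum>j\<in>J. sqnorm (V j *\<^sub>v u)) = sqnorm u" if u: "u \<in> carrier_vec d" for u
  proof -
    have "mat_adjoint (V j) * V j \<in> carrier_mat d d" if "j \<in> J" for j
      using V[OF that] by (meson mat_adjoint_carrier mult_carrier_mat)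
    then have "(sum_mats d (\<lambda>j. mat_adjoint (V j) * V j) J *\<^sub>v u) \<bullet>c u
        = (\<Sum>j\<in>J. ((mat_adjoint (V j) * V j) *\<^sub>v u) \<bullet>c u)"
      using u u by (rule sum_mats_cscalar_prod)
    then have "u \<bullet>c u = (\<Sum>j\<in>J. ((mat_adjoint (V j) * V j) *\<^sub>v u) \<bullet>c u)"
      using u by (simp add: one)
    also have "\<dots> = (\<Sum>j\<in>J. (V j *\<^sub>v u) \<bullet>c (V j *\<^sub>v u))"
    proof (rule sum.cong[OF refl])
      fix j assume j: "j \<in> J"
      have "(mat_adjoint (V j) * V j) *\<^sub>v u = mat_adjoint (V j) *\<^sub>v (V j *\<^sub>v u)"
        by (rule assoc_mult_mat_vec[OF mat_adjoint_carrier[OF V[OF j]] V[OF j] u])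
      then show "((mat_adjoint (V j) * V j) *\<^sub>v u) \<bullet>c u = (V j *\<^sub>v u) \<bullet>c (V j *\<^sub>v u)"
        using mat_adjoint_cscalar_prod[OF V[OF j] u] V[OF j] u by simp
    qed
    finally show ?thesis by (simp add: sqnorm_def)
  qed
  have "sqnorm y = (\<Sum>j\<in>J. Re (((mat_adjoint (V j) * T j * V j) *\<^sub>v x) \<bullet>c y))"
  proof -
    have "mat_adjoint (V j) * T j * V j \<in> carrier_mat d d" if "j \<in> J" for j
      using V[OF that] T[OF that] by (meson mat_adjoint_carrier mult_carrier_mat)
    then have "y \<bullet>c y = (\<Sum>j\<in>J. ((mat_adjoint (V j) * T j * V j) *\<^sub>v x) \<bullet>c y)"
      using sum_mats_cscalar_prod[where J = J and f = "\<lambda>j. mat_adjoint (V j) * T j * V j", OF _ x y]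
      by (simp flip: y_def)
    then show ?thesis by (simp add: sqnorm_def)
  qed
  also have "\<dots> \<le> (\<Sum>j\<in>J. (sqnorm (V j *\<^sub>v x) + sqnorm (V j *\<^sub>v y)) / 2)"
  proof (rule sum_mono)
    fix j assume j: "j \<in> J"
    note [simp] = V[OF j] T[OF j]
    have Vx: "V j *\<^sub>v x \<in> carrier_vec d" and Vy: "V j *\<^sub>v y \<in> carrier_vec d"
      using x y by (auto intro: mult_mat_vec_carrier[where n = d])
    have TVx: "T j *\<^sub>v (V j *\<^sub>v x) \<in> carrier_vec d"
      using Vx by (auto intro: mult_mat_vec_carrier[where n = d])
    have "(mat_adjoint (V j) * T j * V j) *\<^sub>v x = mat_adjoint (V j) *\<^sub>v (T j *\<^sub>v (V j *\<^sub>v x))"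
      using x Vx by (simp add: assoc_mult_mat_vec[where n\<^sub>1 = d and n\<^sub>2 = d and n\<^sub>3 = d]
          mult_carrier_mat[where n = d])
    then have "((mat_adjoint (V j) * T j * V j) *\<^sub>v x) \<bullet>c y = (T j *\<^sub>v (V j *\<^sub>v x)) \<bullet>c (V j *\<^sub>v y)"
      using mat_adjoint_cscalar_prod[OF V[OF j] y TVx] by simp
    then have "Re (((mat_adjoint (V j) * T j * V j) *\<^sub>v x) \<bullet>c y)
        \<le> (sqnorm (T j *\<^sub>v (V j *\<^sub>v x)) + sqnorm (V j *\<^sub>v y)) / 2"
      using Re_cscalar_prod_le[OF TVx Vy] by simp
    with contr[OF j Vx]
    show "Re (((mat_adjoint (V j) * T j * V j) *\<^sub>v x) \<bullet>c y)
        \<le> (sqnorm (V j *\<^sub>v x) + sqnorm (V j *\<^sub>v y)) / 2" by simp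
  qed
  also have "\<dots> = (sqnorm x + sqnorm y) / 2"
    by (simp add: sum_sqnorm[OF x] sum_sqnorm[OF y] sum.distrib flip: sum_divide_distrib)
  finally show ?thesis by (simp add: y_def)
qed

lemma quot_of_fract_divide_to_fract:
  fixes p q :: "complex poly"
  assumes q: "q \<noteq> 0" and ab: "quot_of_fract (to_fract p / to_fract q) = (a, b)"
  shows "a * q = p * b" "b \<noteq> 0" "coprime a b"
proof -
  let ?f = "to_fract p / to_fract q"
  have mem: "(a, b) \<in> normalized_fracts" using quot_of_fract_in_normalized_fracts[of ?f] ab by simp
  then show "coprime a b" and b: "b \<noteq> 0" by (auto simp: normalized_fracts_def)
  have "?f = to_fract a / to_fract b"
    using quot_to_fract_quot_of_fract[of ?f] by (simp add: ab quot_to_fract_def Fract_conv_to_fract)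
  then have "to_fract (a * q) = to_fract (p * b)"
    using q b by (simp add: field_simps)
  then show "a * q = p * b" by (simp only: to_fract_eq_iff)
qed

lemma rat_eval_divide:
  assumes qz: "poly q z \<noteq> 0"
  shows "\<not> rat_pole (to_fract p / to_fract q) z"
    and "rat_eval (to_fract p / to_fract q) z = poly p z / poly q z"
proof -
  obtain a b where ab: "quot_of_fract (to_fract p / to_fract q) = (a, b)" by force
  have q: "q \<noteq> 0" using qz by auto
  note f = quot_of_fract_divide_to_fract[OF q ab]
  have eq: "poly a z * poly q z = poly p z * poly b z"
    using f(1) by (metis poly_mult)
  have bz: "poly b z \<noteq> 0"
  proof
    assume "poly b z = 0"
    moreover from this eq qz have "poly a z = 0" by simp
    ultimately have "[:-z, 1:] dvd a" "[:-z, 1:] dvd b" by (simp_all add: poly_eq_0_iff_dvd)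
    then have "[:-z, 1:] dvd 1" using f(3) not_coprimeI by (metis coprime_common_divisor)
    then show False by simp
  qed
  show "\<not> rat_pole (to_fract p / to_fract q) z"
    using bz ab by (simp add: rat_pole_def)
  show "rat_eval (to_fract p / to_fract q) z = poly p z / poly q z"
    using bz qz eq ab by (simp add: rat_eval_def field_simps)
qed

interpretation map_poly_cnj: comm_ring_hom "map_poly cnj"
proof -
  interpret cnj: comm_ring_hom cnj by unfold_locales auto
  interpret map_poly_comm_ring_hom cnj ..
  show "comm_ring_hom (map_poly cnj)" ..
qed

lemma poly_map_poly_cnj: "poly (map_poly cnj p) (cnj x) = cnj (poly p x)"
  by (induction p) (auto simp: map_poly_pCons)

text \<open>
  The point \<open>x\<close> may be a common zero of \<open>p\<close> and \<open>q\<close>, so reality has to be transferred to the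
  representation in lowest terms.
\<close>

lemma rat_eval_divide_real:
  assumes q: "q \<noteq> 0" and rp: "map_poly cnj p = p" and rq: "map_poly cnj q = q"
  shows "rat_eval (to_fract p / to_fract q) (of_real x) \<in> \<real>"
proof -
  obtain a b where ab: "quot_of_fract (to_fract p / to_fract q) = (a, b)" by force
  note f = quot_of_fract_divide_to_fract[OF q ab]
  let ?a = "map_poly cnj a" and ?b = "map_poly cnj b"
  have f': "?a * q = p * ?b"
    using arg_cong[OF f(1), of "map_poly cnj"] by (simp add: map_poly_cnj.hom_mult rp rq)
  have "(a * ?b) * q = (b * ?a) * q"
  proof -
    have "(a * ?b) * q = (a * q) * ?b" by (simp add: mult_ac)
    also have "\<dots> = b * (p * ?b)" by (simp add: f(1) mult_ac)
    also have "\<dots> = (b * ?a) * q" by (simp add: mult_ac flip: f')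
    finally show ?thesis .
  qed
  then have "a * ?b = b * ?a" using q by simp
  then have "poly a (of_real x) * poly ?b (of_real x) = poly b (of_real x) * poly ?a (of_real x)"
    by (metis poly_mult)
  then have "poly a (of_real x) * cnj (poly b (of_real x))
      = poly b (of_real x) * cnj (poly a (of_real x))"
    using poly_map_poly_cnj[of a "of_real x"] poly_map_poly_cnj[of b "of_real x"] by simp
  then have "cnj (poly a (of_real x) / poly b (of_real x)) = poly a (of_real x) / poly b (of_real x)"
    by (cases "poly b (of_real x) = 0") (auto simp: field_simps)
  then show ?thesis by (simp add: rat_eval_def ab Reals_cnj_iff)
qed

lemma real_matrix_iff: "real_matrix M \<longleftrightarrow> (\<forall>i<dim_row M. \<forall>j<dim_col M. M $$ (i, j) \<in> \<real>)"
  by (auto simp: real_matrix_def)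

lemma real_matrix_four_blockD:
  assumes "real_matrix (four_block_mat A B C D)"
    and "A \<in> carrier_mat r1 c1" "B \<in> carrier_mat r1 c2" "C \<in> carrier_mat r2 c1" "D \<in> carrier_mat r2 c2"
  shows "real_matrix A" "real_matrix B" "real_matrix C" "real_matrix D"
proof -
  have M: "four_block_mat A B C D $$ (i, j) \<in> \<real>" if "i < r1 + r2" "j < c1 + c2" for i j
    using assms that by (simp add: real_matrix_iff)
  show "real_matrix A"
    unfolding real_matrix_iff
  proof (intro allI impI)
    fix i j assume "i < dim_row A" "j < dim_col A"
    then show "A $$ (i, j) \<in> \<real>" using assms(2-) M[of i j] by simp
  qed
  show "real_matrix B"
    unfolding real_matrix_iff
  proof (intro allI impI)
    fix i j assume "i < dim_row B" "j < dim_col B"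
    then show "B $$ (i, j) \<in> \<real>" using assms(2-) M[of i "c1 + j"] by simp
  qed
  show "real_matrix C"
    unfolding real_matrix_iff
  proof (intro allI impI)
    fix i j assume "i < dim_row C" "j < dim_col C"
    then show "C $$ (i, j) \<in> \<real>" using assms(2-) M[of "r1 + i" j] by simp
  qed
  show "real_matrix D"
    unfolding real_matrix_iff
  proof (intro allI impI)
    fix i j assume "i < dim_row D" "j < dim_col D"
    then show "D $$ (i, j) \<in> \<real>" using assms(2-) M[of "r1 + i" "c1 + j"] by simp
  qed
qed

definition realization_numerator ::
  "complex mat \<Rightarrow> complex mat \<Rightarrow> complex mat \<Rightarrow> complex mat \<Rightarrow> complex poly mat" where
  "realization_numerator A B C D =
     map_mat (\<lambda>c. [:c:]) C * adj_mat (char_poly_matrix A) * map_mat (\<lambda>c. [:c:]) B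
       + char_poly A \<cdot>\<^sub>m map_mat (\<lambda>c. [:c:]) D"

lemma char_poly_nonzero:
  fixes A :: "complex mat"
  assumes "A \<in> carrier_mat n n"
  shows "char_poly A \<noteq> 0"
  using degree_monic_char_poly[OF assms] by auto

lemma adj_mat_hom:
  assumes h: "comm_ring_hom h" and M: "M \<in> carrier_mat n n"
  shows "adj_mat (map_mat h M) = map_mat h (adj_mat M)"
proof -
  interpret comm_ring_hom h by fact
  have "mat_delete (map_mat h M) i j = map_mat h (mat_delete M i j)" if "i < n" "j < n" for i j
    using M that by (intro eq_matI) (auto simp: mat_delete_def)
  with M show ?thesis
    by (intro eq_matI) (auto simp: adj_mat_def cofactor_def hom_distribs)
qed

lemma smult_mat_mult_vec:
  fixes c :: "'a :: comm_semiring_0"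
  assumes "M \<in> carrier_mat nr nc" "w \<in> carrier_vec nc"
  shows "(c \<cdot>\<^sub>m M) *\<^sub>v w = c \<cdot>\<^sub>v (M *\<^sub>v w)"
  using assms by (intro eq_vecI) (auto simp: scalar_prod_def sum_distrib_left mult.assoc)

context
  fixes n m :: nat and A B C D :: "complex mat"
  assumes A: "A \<in> carrier_mat n n" and B: "B \<in> carrier_mat n m"
    and C: "C \<in> carrier_mat m n" and D: "D \<in> carrier_mat m m"
begin

lemma realization_numerator_carrier: "realization_numerator A B C D \<in> carrier_mat m m"
  using A B C D by (auto simp: realization_numerator_def)

lemma mat_inverse_char_poly_matrix:
  "the (mat_inverse (map_mat to_fract (char_poly_matrix A)))
     = (1 / to_fract (char_poly A)) \<cdot>\<^sub>m map_mat to_fract (adj_mat (char_poly_matrix A))"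
    (is "the (mat_inverse ?M) = ?c \<cdot>\<^sub>m ?J")
proof -
  interpret comm_ring_hom "to_fract :: complex poly \<Rightarrow> rat_fun" by unfold_locales auto
  have cM: "char_poly_matrix A \<in> carrier_mat n n" using A by simp
  note adj = adj_mat[OF cM]
  have M: "?M \<in> carrier_mat n n" and J: "?J \<in> carrier_mat n n" using cM adj by auto
  have cJ: "?c \<cdot>\<^sub>m ?J \<in> carrier_mat n n" using J by simp
  have "?M * ?J = map_mat to_fract (char_poly A \<cdot>\<^sub>m 1\<^sub>m n)"
    using mat_hom_mult[OF cM adj(1)] adj(2) by (simp add: char_poly_def)
  then have "?M * (?c \<cdot>\<^sub>m ?J) = ?c \<cdot>\<^sub>m map_mat to_fract (char_poly A \<cdot>\<^sub>m 1\<^sub>m n)"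
    using M J by (simp add: mult_smult_distrib[where n = n])
  also have "\<dots> = 1\<^sub>m n"
    using char_poly_nonzero[OF A] by (intro eq_matI) auto
  finally have inv: "?M * (?c \<cdot>\<^sub>m ?J) = 1\<^sub>m n" .
  have inv': "(?c \<cdot>\<^sub>m ?J) * ?M = 1\<^sub>m n"
    by (rule mat_mult_left_right_inverse[OF M cJ inv])
  have "?M \<in> Units (ring_mat TYPE(rat_fun) n ())"
    using M cJ inv inv' by (auto simp: Units_def ring_mat_def)
  then obtain X where X: "mat_inverse ?M = Some X"
    using mat_inverse(1)[OF M, where b = "()"] by (cases "mat_inverse ?M") auto
  have XM: "X * ?M = 1\<^sub>m n" and cX: "X \<in> carrier_mat n n" using mat_inverse(2)[OF M X] by auto
  have "X = X * (?M * (?c \<cdot>\<^sub>m ?J))" using cX inv by simp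
  also have "\<dots> = (X * ?M) * (?c \<cdot>\<^sub>m ?J)"
    using assoc_mult_mat[OF cX M cJ] by simp
  also have "\<dots> = ?c \<cdot>\<^sub>m ?J" unfolding XM by (rule left_mult_one_mat[OF cJ])
  finally show ?thesis using X by simp
qed

lemma realized_fun_eq:
  "realized_fun A B C D
     = map_mat (\<lambda>p. to_fract p / to_fract (char_poly A)) (realization_numerator A B C D)"
proof -
  interpret comm_ring_hom "to_fract :: complex poly \<Rightarrow> rat_fun" by unfold_locales auto
  let ?J = "adj_mat (char_poly_matrix A)"
  let ?c = "1 / to_fract (char_poly A)"
  let ?K = "map_mat (\<lambda>c. [:c:])"
  have J: "?J \<in> carrier_mat n n" using A adj_mat(1)[of "char_poly_matrix A" n] by simp
  have K: "const_mat X = map_mat to_fract (?K X)" for X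
    by (intro eq_matI) (auto simp: const_mat_def)
  have CJ: "map_mat to_fract (?K C) * map_mat to_fract ?J = map_mat to_fract (?K C * ?J)"
    using C J by (subst mat_hom_mult[where n = n]) auto
  have CJB: "map_mat to_fract (?K C * ?J) * map_mat to_fract (?K B)
      = map_mat to_fract (?K C * ?J * ?K B)"
    using B C J by (subst mat_hom_mult[where n = n]) auto
  have "const_mat C * (?c \<cdot>\<^sub>m map_mat to_fract ?J) * const_mat B
      = ?c \<cdot>\<^sub>m map_mat to_fract (?K C * ?J * ?K B)"
    unfolding K CJB[symmetric] CJ[symmetric]
    using B C J by (simp add: mult_smult_distrib[where n = n and nr = m and nc = n]
        mult_smult_assoc_mat[where n = n and nr = m and nc = m])
  then have "realized_fun A B C D
      = ?c \<cdot>\<^sub>m map_mat to_fract (?K C * ?J * ?K B) + map_mat to_fract (?K D)"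
    by (simp add: realized_fun_def mat_inverse_char_poly_matrix K)
  also have "\<dots> = map_mat (\<lambda>p. to_fract p / to_fract (char_poly A)) (realization_numerator A B C D)"
    unfolding realization_numerator_def
    using char_poly_nonzero[OF A] B C D
    by (intro eq_matI) (auto simp: hom_add hom_mult add_divide_distrib
        simp del: index_mult_mat(1) mult_pCons_right)
  finally show ?thesis .
qed

lemma realized_fun_carrier: "realized_fun A B C D \<in> carrier_mat m m"
  using realization_numerator_carrier by (simp add: realized_fun_eq)

lemma realized_fun_no_pole:
  assumes "poly (char_poly A) z \<noteq> 0"
  shows "\<not> mat_pole (realized_fun A B C D) z"
  using rat_eval_divide(1)[OF assms]
  by (auto simp: mat_pole_def realized_fun_eq elements_mat_def)

lemma state_of_realized_fun:
  assumes z: "poly (char_poly A) z \<noteq> 0" and u: "u \<in> carrier_vec m"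
  obtains x where "x \<in> carrier_vec n" "A *\<^sub>v x + B *\<^sub>v u = z \<cdot>\<^sub>v x"
    "C *\<^sub>v x + D *\<^sub>v u = mat_eval (realized_fun A B C D) z *\<^sub>v u"
proof -
  let ?e = "\<lambda>p::complex poly. poly p z"
  let ?K = "map_mat (\<lambda>c. [:c:])"
  define J where "J = map_mat ?e (adj_mat (char_poly_matrix A))"
  define c where "c = poly (char_poly A) z"
  have c: "c \<noteq> 0" using z by (simp add: c_def)
  have cM: "char_poly_matrix A \<in> carrier_mat n n" using A by simp
  note adj = adj_mat[OF cM]
  have J: "J \<in> carrier_mat n n" using adj(1) by (simp add: J_def)
  have K: "map_mat ?e (?K X) = X" for X by (intro eq_matI) auto
  have eval: "mat_eval (realized_fun A B C D) z = (1 / c) \<cdot>\<^sub>m (C * J * B) + D"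
  proof -
    have CJ: "map_mat ?e (?K C * adj_mat (char_poly_matrix A)) = C * J"
      using C adj(1) by (subst semiring_hom.mat_hom_mult[where n = n, OF poly_hom.semiring_hom_axioms]) (auto simp: K J_def)
    define X where "X = ?K C * adj_mat (char_poly_matrix A) * ?K B"
    have X: "X \<in> carrier_mat m m" 
      unfolding X_def
      using B C adj(1) by (intro mult_carrier_mat[where n = n]) simp_all
    from CJ have eX: "map_mat ?e X = C * J * B"
      unfolding X_def
      using B C adj(1) by (subst semiring_hom.mat_hom_mult[where n = n, OF poly_hom.semiring_hom_axioms]) (auto simp: K)
    have "map_mat ?e (realization_numerator A B C D) = C * J * B + c \<cdot>\<^sub>m D"
      unfolding eX[symmetric] realization_numerator_def X_def[symmetric]
      using X D by (intro eq_matI) (auto simp: c_def)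
    moreover have "mat_eval (realized_fun A B C D) z
        = (1 / c) \<cdot>\<^sub>m map_mat ?e (realization_numerator A B C D)"
      using rat_eval_divide(2)[OF z]
      by (intro eq_matI) (auto simp: mat_eval_def realized_fun_eq c_def)
    moreover have "(1 / c) \<cdot>\<^sub>m (Y + c \<cdot>\<^sub>m D) = (1 / c) \<cdot>\<^sub>m Y + D" if "Y \<in> carrier_mat m m" for Y
      using that c D by (intro eq_matI) (auto simp: ring_distribs)
    moreover have "C * J * B \<in> carrier_mat m m" using B C J by auto
    ultimately show ?thesis by simp
  qed
  have "map_mat ?e (char_poly_matrix A) = z \<cdot>\<^sub>m 1\<^sub>m n - A"
    using A by (intro eq_matI) (auto simp: char_poly_matrix_def)
  moreover have "map_mat ?e (char_poly_matrix A) * J = map_mat ?e (char_poly A \<cdot>\<^sub>m 1\<^sub>m n)"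
    using semiring_hom.mat_hom_mult[OF poly_hom.semiring_hom_axioms cM adj(1)] adj(2) by (simp add: char_poly_def J_def)
  moreover have "map_mat ?e (char_poly A \<cdot>\<^sub>m 1\<^sub>m n) = c \<cdot>\<^sub>m 1\<^sub>m n"
    by (intro eq_matI) (auto simp: c_def)
  ultimately have zJ: "(z \<cdot>\<^sub>m 1\<^sub>m n - A) * J = c \<cdot>\<^sub>m 1\<^sub>m n" by simp
  define x where "x = (1 / c) \<cdot>\<^sub>v (J *\<^sub>v (B *\<^sub>v u))"
  have Bu: "B *\<^sub>v u \<in> carrier_vec n" and x: "x \<in> carrier_vec n"
    using B J u by (auto simp: x_def)
  have one: "(a \<cdot>\<^sub>m 1\<^sub>m n) *\<^sub>v w = a \<cdot>\<^sub>v w" if "w \<in> carrier_vec n" for a :: complex and w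
    using that by (simp add: smult_mat_mult_vec[OF one_carrier_mat])
  have zA: "z \<cdot>\<^sub>m 1\<^sub>m n - A \<in> carrier_mat n n" using A by (simp add: minus_carrier_mat)
  have "z \<cdot>\<^sub>v x - A *\<^sub>v x = (z \<cdot>\<^sub>m 1\<^sub>m n - A) *\<^sub>v x"
    using minus_mult_distrib_mat_vec[OF _ A x, of "z \<cdot>\<^sub>m 1\<^sub>m n"] one[OF x] by simp
  also have "\<dots> = (1 / c) \<cdot>\<^sub>v ((z \<cdot>\<^sub>m 1\<^sub>m n - A) *\<^sub>v (J *\<^sub>v (B *\<^sub>v u)))"
    unfolding x_def using zA J Bu by (intro mult_mat_vec) auto
  also have "(z \<cdot>\<^sub>m 1\<^sub>m n - A) *\<^sub>v (J *\<^sub>v (B *\<^sub>v u)) = (c \<cdot>\<^sub>m 1\<^sub>m n) *\<^sub>v (B *\<^sub>v u)"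
    using assoc_mult_mat_vec[OF zA J Bu] by (simp add: zJ)
  also have "(1 / c) \<cdot>\<^sub>v \<dots> = B *\<^sub>v u"
    using c Bu by (simp add: one[OF Bu] smult_smult_assoc)
  finally have state: "z \<cdot>\<^sub>v x - A *\<^sub>v x = B *\<^sub>v u" .
  have "A *\<^sub>v x + B *\<^sub>v u = z \<cdot>\<^sub>v x"
    unfolding state[symmetric] using A x by (intro eq_vecI) auto
  moreover have "C *\<^sub>v x + D *\<^sub>v u = mat_eval (realized_fun A B C D) z *\<^sub>v u"
  proof -
    have CJ: "C * J \<in> carrier_mat m n" and CJB: "C * J * B \<in> carrier_mat m m"
      using B C J by auto
    have "mat_eval (realized_fun A B C D) z *\<^sub>v u
        = ((1 / c) \<cdot>\<^sub>m (C * J * B)) *\<^sub>v u + D *\<^sub>v u"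
      unfolding eval using CJB D u by (intro add_mult_distrib_mat_vec) auto
    also have "((1 / c) \<cdot>\<^sub>m (C * J * B)) *\<^sub>v u = (1 / c) \<cdot>\<^sub>v ((C * J * B) *\<^sub>v u)"
      by (rule smult_mat_mult_vec[OF CJB u])
    also have "(C * J * B) *\<^sub>v u = C *\<^sub>v (J *\<^sub>v (B *\<^sub>v u))"
      using assoc_mult_mat_vec[OF CJ B u] assoc_mult_mat_vec[OF C J Bu] by simp
    also have "(1 / c) \<cdot>\<^sub>v \<dots> = C *\<^sub>v x"
      unfolding x_def using C J Bu by (intro mult_mat_vec[symmetric]) auto
    finally show ?thesis by simp
  qed
  ultimately show thesis using x that by blast
qed

lemma realized_fun_real_rational:
  assumes "real_matrix A" "real_matrix B" "real_matrix C" "real_matrix D"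
  shows "real_rational (realized_fun A B C D)"
proof -
  let ?h = "map_mat (map_poly cnj)" and ?K = "map_mat (\<lambda>c. [:c:])"
  have h: "comm_ring_hom (map_poly cnj)" ..
  have real: "cnj (X $$ (i, j)) = X $$ (i, j)"
    if "real_matrix X" "i < dim_row X" "j < dim_col X" for X i j
    using that by (simp add: real_matrix_iff Reals_cnj_iff)
  have K: "?h (?K X) = ?K X" if "real_matrix X" for X
    using real[OF that] by (intro eq_matI) (auto simp: map_poly_pCons)
  have cM: "char_poly_matrix A \<in> carrier_mat n n" using A by simp
  have hM: "?h (char_poly_matrix A) = char_poly_matrix A"
    using real[OF assms(1)] A
    by (intro eq_matI) (auto simp: char_poly_matrix_def map_poly_pCons map_poly_cnj.hom_add map_poly_cnj.hom_mult)
  then have hJ: "?h (adj_mat (char_poly_matrix A)) = adj_mat (char_poly_matrix A)"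
    using adj_mat_hom[OF h cM] by simp
  have hc: "map_poly cnj (char_poly A) = char_poly A"
    using map_poly_cnj.hom_det[of "char_poly_matrix A"] hM by (simp add: char_poly_def)
  have J: "adj_mat (char_poly_matrix A) \<in> carrier_mat n n" using adj_mat(1)[OF cM] .
  have hCJ: "?h (?K C * adj_mat (char_poly_matrix A)) = ?K C * adj_mat (char_poly_matrix A)"
    using C J by (subst map_poly_cnj.mat_hom_mult[where n = n]) (auto simp: K assms hJ)
  define X where "X = ?K C * adj_mat (char_poly_matrix A) * ?K B"
  have X: "X \<in> carrier_mat m m" 
    unfolding X_def
    using B C J by (intro mult_carrier_mat[where n = n]) simp_all
  from hCJ have hX: "?h X = X"
    unfolding X_def
    using B C J by (subst map_poly_cnj.mat_hom_mult[where n = n]) (auto simp: K assms)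
  define Y where "Y = char_poly A \<cdot>\<^sub>m ?K D"
  have Y: "Y \<in> carrier_mat m m" using D by (simp add: Y_def)
  have "?h (p \<cdot>\<^sub>m M) = map_poly cnj p \<cdot>\<^sub>m ?h M" for p M
    by (intro eq_matI) (auto simp: map_poly_cnj.hom_mult)
  then have hY: "?h Y = Y" by (simp add: Y_def hc K assms)
  have hN: "?h (realization_numerator A B C D) = realization_numerator A B C D"
  proof -
    have "?h (X + Y) = ?h X + ?h Y"
      using X Y by (intro eq_matI) (auto simp: map_poly_cnj.hom_add)
    then show ?thesis by (simp add: realization_numerator_def hX hY flip: X_def Y_def)
  qed
  show ?thesis
    unfolding real_rational_def real_matrix_def
  proof (intro allI impI subsetI)
    fix x :: real and y
    assume "y \<in> elements_mat (mat_eval (realized_fun A B C D) (complex_of_real x))"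
    then obtain i j where ij: "i < m" "j < m"
      and y: "y = rat_eval (to_fract (realization_numerator A B C D $$ (i, j))
        / to_fract (char_poly A)) (of_real x)"
      using realization_numerator_carrier
      by (auto simp: elements_mat_def mat_eval_def realized_fun_eq)
    have "map_poly cnj (realization_numerator A B C D $$ (i, j)) = realization_numerator A B C D $$ (i, j)"
      using arg_cong[OF hN, of "\<lambda>M. M $$ (i, j)"] ij realization_numerator_carrier by auto
    then show "y \<in> \<real>"
      unfolding y by (rule rat_eval_divide_real[OF char_poly_nonzero[OF A] _ hc])
  qed
qed

context
  assumes contr: "\<And>w. w \<in> carrier_vec (n + m) \<Longrightarrow> sqnorm (four_block_mat A B C D *\<^sub>v w) \<le> sqnorm w"
begin

lemma sqnorm_block_le:
  assumes x: "x \<in> carrier_vec n" and u: "u \<in> carrier_vec m"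
  shows "sqnorm (A *\<^sub>v x + B *\<^sub>v u) + sqnorm (C *\<^sub>v x + D *\<^sub>v u) \<le> sqnorm x + sqnorm u"
  using contr[of "x @\<^sub>v u"] x u
  by (simp add: four_block_mat_mult_vec[OF A B C D x u] sqnorm_append)

lemma char_poly_contraction_nonzero:
  assumes z: "1 < cmod z"
  shows "poly (char_poly A) z \<noteq> 0"
proof
  assume "poly (char_poly A) z = 0"
  then obtain x where x: "x \<in> carrier_vec n" "x \<noteq> 0\<^sub>v n" and Ax: "A *\<^sub>v x = z \<cdot>\<^sub>v x"
    using eigenvalue_root_char_poly[OF A] A by (auto simp: eigenvalue_def eigenvector_def)
  have "A *\<^sub>v x + B *\<^sub>v 0\<^sub>v m = z \<cdot>\<^sub>v x"
    using A B x Ax by (intro eq_vecI) auto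
  with sqnorm_block_le[OF x(1) zero_carrier_vec]
  have "(cmod z)\<^sup>2 * sqnorm x \<le> sqnorm x"
    using sqnorm_nonneg[of "C *\<^sub>v x + D *\<^sub>v 0\<^sub>v m"] by (simp add: sqnorm_smult sqnorm_zero_vec)
  moreover have "1 < (cmod z)\<^sup>2" using z by (simp add: one_less_power)
  moreover have "0 < sqnorm x"
    using sqnorm_nonneg[of x] sqnorm_eq_0[OF x(1)] x(2) by fastforce
  ultimately show False by simp
qed

lemma realized_fun_discrete_bounded: "realized_fun A B C D \<in> discrete_bounded m"
  unfolding discrete_bounded_def
proof (intro CollectI conjI allI impI)
  show "realized_fun A B C D \<in> carrier_mat m m" by (rule realized_fun_carrier)
next
  fix z assume "1 < cmod z"
  then show "\<not> mat_pole (realized_fun A B C D) z"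
    by (intro realized_fun_no_pole char_poly_contraction_nonzero)
next
  fix z assume z: "1 < cmod z"
  let ?F = "mat_eval (realized_fun A B C D) z"
  have F: "?F \<in> carrier_mat m m" using realized_fun_carrier by (simp add: mat_eval_def)
  have "sqnorm (?F *\<^sub>v u) \<le> sqnorm u" if u: "u \<in> carrier_vec m" for u
  proof -
    obtain x where x: "x \<in> carrier_vec n" "A *\<^sub>v x + B *\<^sub>v u = z \<cdot>\<^sub>v x" "C *\<^sub>v x + D *\<^sub>v u = ?F *\<^sub>v u"
      using state_of_realized_fun[OF char_poly_contraction_nonzero[OF z] u] .
    have "(cmod z)\<^sup>2 * sqnorm x + sqnorm (?F *\<^sub>v u) \<le> sqnorm x + sqnorm u"
      using sqnorm_block_le[OF x(1) u] by (simp add: x sqnorm_smult)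
    moreover have "1 * sqnorm x \<le> (cmod z)\<^sup>2 * sqnorm x"
      using z by (intro mult_right_mono sqnorm_nonneg) (simp add: one_le_power)
    ultimately show ?thesis by simp
  qed
  then show "psd m (1\<^sub>m m - mat_adjoint ?F * ?F)"
    using psd_one_minus_adjoint_mult_iff[OF F] by blast
qed

end

end

theorem corollary5p3:
  fixes k n m :: nat
    and Fs :: "nat \<Rightarrow> rat_fun mat"
    and As Bs Cs Ds Rs vn vm v :: "nat \<Rightarrow> complex mat"
    and A B C D R :: "complex mat"
    and F :: "rat_fun mat"
  assumes
    "\<And>j. j \<in> {1..k} \<Longrightarrow> Fs j \<in> carrier_mat m m"
    "\<And>j. j \<in> {1..k} \<Longrightarrow> As j \<in> carrier_mat n n"
    "\<And>j. j \<in> {1..k} \<Longrightarrow> Bs j \<in> carrier_mat n m"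
    "\<And>j. j \<in> {1..k} \<Longrightarrow> Cs j \<in> carrier_mat m n"
    "\<And>j. j \<in> {1..k} \<Longrightarrow> Ds j \<in> carrier_mat m m"
    "\<And>j. j \<in> {1..k} \<Longrightarrow> Rs j = four_block_mat (As j) (Bs j) (Cs j) (Ds j)"
    "\<And>j. j \<in> {1..k} \<Longrightarrow> Fs j = realized_fun (As j) (Bs j) (Cs j) (Ds j)"
    "\<And>j. j \<in> {1..k} \<Longrightarrow> psd (n + m) (1\<^sub>m (n + m) - mat_adjoint (Rs j) * 1\<^sub>m (n + m) * Rs j)"
    "\<And>j. j \<in> {1..k} \<Longrightarrow> vn j \<in> carrier_mat n n"
    "\<And>j. j \<in> {1..k} \<Longrightarrow> vm j \<in> carrier_mat m m"
    "\<And>j. j \<in> {1..k} \<Longrightarrow> v j = four_block_mat (vn j) (0\<^sub>m n m) (0\<^sub>m m n) (vm j)"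
    "sum_mats (n + m) (\<lambda>j. mat_adjoint (v j) * v j) {1..k} = 1\<^sub>m (n + m)"
    "R = sum_mats (n + m) (\<lambda>j. mat_adjoint (v j) * Rs j * v j) {1..k}"
    "A \<in> carrier_mat n n" "B \<in> carrier_mat n m" "C \<in> carrier_mat m n" "D \<in> carrier_mat m m"
    "R = four_block_mat A B C D"
    "F = realized_fun A B C D"
  shows "psd (n + m) (1\<^sub>m (n + m) - mat_adjoint R * R)
    \<and> F \<in> discrete_bounded m
    \<and> (real_matrix R \<longrightarrow> F \<in> DB m)"
proof -
  let ?d = "n + m"
  have Rs: "Rs j \<in> carrier_mat ?d ?d" if "j \<in> {1..k}" for j
    using assms(2)[OF that] assms(5)[OF that] unfolding assms(6)[OF that] by (rule four_block_carrier_mat)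
  have v: "v j \<in> carrier_mat ?d ?d" if "j \<in> {1..k}" for j
    using assms(9)[OF that] assms(10)[OF that] unfolding assms(11)[OF that] by (rule four_block_carrier_mat)
  have contr: "sqnorm (Rs j *\<^sub>v u) \<le> sqnorm u" if j: "j \<in> {1..k}" and u: "u \<in> carrier_vec ?d" for j u
  proof -
    have "mat_adjoint (Rs j) * 1\<^sub>m ?d = mat_adjoint (Rs j)" 
      using Rs[OF j] by (intro right_mult_one_mat[where nr = ?d]) simp
    with assms(8)[OF j] psd_one_minus_adjoint_mult_iff[OF Rs[OF j]] u show ?thesis by simp
  qed
  have R: "R \<in> carrier_mat ?d ?d" by (simp add: assms(13) sum_mats_def)
  have contr_R: "sqnorm (R *\<^sub>v u) \<le> sqnorm u" if "u \<in> carrier_vec ?d" for u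
    unfolding assms(13) using Rs v contr assms(12) that by (rule contraction_sum_mats)
  note ABCD = assms(14-17)
  have "psd ?d (1\<^sub>m ?d - mat_adjoint R * R)"
    using psd_one_minus_adjoint_mult_iff[OF R] contr_R by blast
  moreover have bounded: "F \<in> discrete_bounded m"
    unfolding assms(19)
    using realized_fun_discrete_bounded[OF ABCD] contr_R by (simp add: assms(18))
  moreover have "F \<in> DB m" if "real_matrix R"
  proof -
    have "real_matrix A" "real_matrix B" "real_matrix C" "real_matrix D"
      using real_matrix_four_blockD[OF that[unfolded assms(18)] ABCD] by simp_all
    with bounded show ?thesis
      unfolding assms(19) by (simp add: DB_def realized_fun_real_rational[OF ABCD])
  qed
  ultimately show ?thesis by blast
qed

end
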